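(* For all integers $n,m\ge 0$ and $r$ with $0\le r\le n-1$, $$\sum_{i=0}^{2^n-1}(-1)^{s_2(i)}\bigl(2^rs_2(i)-i\bigr)^m=0.$$
   Context: $s_2(i)$ denotes the sum of the binary digits of $i$. The convention $0^0=1$ is used. *)

theory Defs
  imports Main
begin

(* The binary digit of i at position j is i div 2 ^ j mod 2.  It vanishes for
   j >= i, because i < 2 ^ i, so the range j < i covers all the nonzero digits. *)
definition s2 :: "nat \<Rightarrow> nat" where
  "s2 i = (\<Sum>j<i. i div 2 ^ j mod 2)"

end

theory Submission
  imports Defs
begin

text \<open>
  Expanding \<open>i\<close> in binary turns \<open>2 ^ r * s2 i - i\<close> into the sum of \<open>2 ^ r - 2 ^ j\<close> over the
  positions \<open>j\<close> of the ones of \<open>i\<close>.  The position \<open>r\<close> contributes \<open>0\<close> to this sum, so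
  flipping the digit of \<open>i\<close> at \<open>r\<close> leaves the base of the power unchanged, while it changes
  \<open>s2 i\<close> by one and hence reverses the sign (lemma \<open>summand_flip_bit\<close>).  As \<open>r < n\<close>, the flip
  is an involution of the numbers below \<open>2 ^ n\<close>, and the sum equals its own negative.
\<close>

lemma bits_nat_subset: "{j. bit i j} \<subseteq> {..<i}" for i :: nat
proof
  fix j assume "j \<in> {j. bit i j}"
  then have "odd (i div 2 ^ j)"
    by (simp add: bit_iff_odd)
  then have "\<not> i < 2 ^ j"
    by (metis div_less even_zero)
  then show "j \<in> {..<i}"
    using less_le_trans[OF less_exp[of j], of i] by simp
qed

lemma finite_bits_nat: "finite {j. bit i j}" for i :: nat
  by (rule finite_subset[OF bits_nat_subset]) simp

lemma flip_bit_flip_bit_nat: "flip_bit r (flip_bit r i) = i" for i :: nat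
  by (rule bit_eqI) (auto simp: bit_flip_bit_iff)

text \<open>
  Counting ones instead of adding digits frees the digit sum from its summation range,
  which depends on the number and would have to be adjusted whenever a digit is flipped.
\<close>

lemma s2_eq_card_bits: "s2 i = card {j. bit i j}"
proof -
  have "s2 i = (\<Sum>j<i. of_bool (bit i j))"
    unfolding s2_def by (intro sum.cong) (auto simp: bit_iff_odd mod_2_eq_odd)
  also have "\<dots> = card ({..<i} \<inter> {j. bit i j})"
    by simp
  also have "{..<i} \<inter> {j. bit i j} = {j. bit i j}"
    using bits_nat_subset[of i] by (rule Int_absorb1)
  finally show ?thesis .
qed

lemma s2_set_bit:
  assumes "\<not> bit i r"
  shows "s2 (set_bit r i) = Suc (s2 i)"
proof -
  have "{j. bit (set_bit r i) j} = insert r {j. bit i j}"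
    by (auto simp: bit_set_bit_iff)
  then show ?thesis
    using assms finite_bits_nat[of i] by (simp add: s2_eq_card_bits)
qed

lemma summand_flip_bit:
  "(- 1) ^ s2 (flip_bit r i) * (2 ^ r * int (s2 (flip_bit r i)) - int (flip_bit r i)) ^ m
    = - ((- 1) ^ s2 i * (2 ^ r * int (s2 i) - int i) ^ m)"
proof -
  have raise: "(- 1) ^ s2 (flip_bit r k) * (2 ^ r * int (s2 (flip_bit r k)) - int (flip_bit r k)) ^ m
      = - ((- 1) ^ s2 k * (2 ^ r * int (s2 k) - int k) ^ m)" if "\<not> bit k r" for k
  proof -
    have flip: "flip_bit r k = set_bit r k"
      using that by (simp add: flip_bit_eq_if)
    moreover have "set_bit r k = k + 2 ^ r"
      using that by (simp add: set_bit_eq)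
    ultimately have "2 ^ r * int (s2 (flip_bit r k)) - int (flip_bit r k) = 2 ^ r * int (s2 k) - int k"
      using s2_set_bit[OF that] by (simp add: algebra_simps)
    then show ?thesis
      using s2_set_bit[OF that] flip by simp
  qed
  show ?thesis
  proof (cases "bit i r")
    case False
    then show ?thesis by (rule raise)
  next
    case True
    \<comment> \<open>Now \<open>i\<close> is itself the flip of a number whose digit at \<open>r\<close> is \<open>0\<close>.\<close>
    then have "\<not> bit (flip_bit r i) r"
      by (simp add: bit_flip_bit_iff)
    from raise[OF this] show ?thesis
      by (simp add: flip_bit_flip_bit_nat)
  qed
qed

lemma flip_bit_less_exp:
  fixes i :: nat
  assumes "r < n" "i < 2 ^ n"
  shows "flip_bit r i < 2 ^ n"
proof -
  have "take_bit n (flip_bit r i) = flip_bit r i"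
    using assms by (simp add: take_bit_flip_bit_eq take_bit_nat_eq_self)
  then show ?thesis
    by (simp add: take_bit_nat_eq_self_iff)
qed

theorem corollary2p14:
  fixes n m r :: nat
  assumes "r < n"
  shows "(\<Sum>i = 0..2 ^ n - 1. (- 1) ^ s2 i * (2 ^ r * int (s2 i) - int i) ^ m) = 0"
proof -
  let ?f = "\<lambda>i. (- 1) ^ s2 i * (2 ^ r * int (s2 i) - int i) ^ m"
  have "0 < (2 :: nat) ^ n"
    by simp
  then have "i \<le> 2 ^ n - 1 \<longleftrightarrow> i < 2 ^ n" for i :: nat
    by linarith
  then have range: "{0..2 ^ n - 1} = {i :: nat. i < 2 ^ n}"
    unfolding atLeastAtMost_def atLeast_def atMost_def by blast
  have "(\<Sum>i = 0..2 ^ n - 1. ?f i) = (\<Sum>i = 0..2 ^ n - 1. - ?f i)"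
    unfolding range
    by (rule sum.reindex_bij_witness[where i = "flip_bit r" and j = "flip_bit r"])
      (use assms in \<open>simp_all add: flip_bit_flip_bit_nat flip_bit_less_exp summand_flip_bit\<close>)
  then show ?thesis
    by (simp add: sum_negf)
qed

end
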